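(* Let $\mathfrak{g}=\mathbb{R}e_0\ltimes_M\mathfrak{u}$ be an almost abelian Lie algebra of dimension $2n+1$. Suppose that $\mathfrak{g}$ admits a coKähler structure $(\xi,J,\alpha,\langle\cdot,\cdot\rangle)$, with associated decomposition $\mathfrak{g}=\mathbb{R}\xi\ltimes_D\mathfrak{h}$. Then $\mathfrak{g}$ is unimodular if and only if either $\mathfrak{h}$ is abelian or $[h_0,Jh_0]=0$, where $h_0$ is a unit vector of $\mathfrak{h}$ orthogonal to $\mathfrak{h}\cap\mathfrak{u}$ (defined when $\mathfrak{h}\neq\mathfrak{u}$, in particular whenever $\mathfrak{h}$ is not abelian). Moreover, if $\mathfrak{g}$ is not unimodular, then $\mathfrak{g}$ is the direct product of the non-unimodular, almost abelian Kähler Lie algebra $\mathfrak{h}$ with $\mathbb{R}$, that is, $D=0$.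
   Context: All Lie algebras are real and finite-dimensional. Almost abelian: $\mathfrak{g}=\mathbb{R}e_0\ltimes_M\mathfrak{u}$ means that $\mathfrak{u}$ is an abelian ideal of codimension one, $e_0\notin\mathfrak{u}$, and $M=\mathrm{ad}_{e_0}|_{\mathfrak{u}}$. In general, a Lie algebra is almost abelian if it has an abelian ideal of codimension one. A Lie algebra is unimodular if $\mathrm{tr}(\mathrm{ad}_y)=0$ for all $y$. CoKähler structure: a quadruple consisting of a non-zero $\xi\in\mathfrak{g}$, an endomorphism $J$ of $\mathfrak{g}$, $\alpha\in\mathfrak{g}^*$ and an inner product $\langle\cdot,\cdot\rangle$ on $\mathfrak{g}$ with $\alpha(\xi)=1$, $J^2=-\mathrm{Id}+\alpha\otimes\xi$, $\langle JX,JY\rangle=\langle X,Y\rangle-\alpha(X)\alpha(Y)$, $d\alpha=0$, $N_J=0$, $d\omega=0$, where $\omega(X,Y)=\langle JX,Y\rangle$, $d$ is the Chevalley–Eilenberg differential and $N_J(X,Y)=[JX,JY]-J[JX,Y]-J[X,JY]+J^2[X,Y]$. The associated decomposition is $\mathfrak{g}=\mathbb{R}\xi\ltimes_D\mathfrak{h}$, where $\mathfrak{h}=\ker\alpha=\xi^\perp$ is a Kähler Lie algebra of dimension $2n$ with the restrictions of $J$ and $\langle\cdot,\cdot\rangle$, and $D=\mathrm{ad}_\xi|_{\mathfrak{h}}$ is a skew-symmetric derivation commuting with $J|_{\mathfrak{h}}$. *)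

theory Defs
  imports "HOL-Analysis.Analysis"
begin

text \<open>
  A finite-dimensional real Lie algebra is a linear subspace \<open>L\<close> of some real vector space
  together with a bracket whose behaviour matters on \<open>L\<close> only. Thus an ideal or subalgebra of \<open>L\<close>
  is a Lie algebra for the same bracket, and all notions below are relative to a carrier.
\<close>

definition linear_map_on ::
    "'a::real_vector set \<Rightarrow> 'b::real_vector set \<Rightarrow> ('a \<Rightarrow> 'b) \<Rightarrow> bool" where
  "linear_map_on V W f \<longleftrightarrow>
     (\<forall>x\<in>V. f x \<in> W) \<and>
     (\<forall>x\<in>V. \<forall>y\<in>V. f (x + y) = f x + f y) \<and>
     (\<forall>c. \<forall>x\<in>V. f (c *\<^sub>R x) = c *\<^sub>R f x)"

definition bilinear_map_on ::
    "'a::real_vector set \<Rightarrow> 'b::real_vector set \<Rightarrow> ('a \<Rightarrow> 'a \<Rightarrow> 'b) \<Rightarrow> bool" where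
  "bilinear_map_on V W f \<longleftrightarrow>
     (\<forall>x\<in>V. linear_map_on V W (\<lambda>y. f x y)) \<and>
     (\<forall>y\<in>V. linear_map_on V W (\<lambda>x. f x y))"

definition lie_algebra_on :: "'a::real_vector set \<Rightarrow> ('a \<Rightarrow> 'a \<Rightarrow> 'a) \<Rightarrow> bool" where
  "lie_algebra_on L br \<longleftrightarrow>
     (\<exists>B. finite B \<and> L = span B) \<and>
     bilinear_map_on L L br \<and>
     (\<forall>x\<in>L. br x x = 0) \<and>
     (\<forall>x\<in>L. \<forall>y\<in>L. \<forall>z\<in>L. br x (br y z) + br y (br z x) + br z (br x y) = 0)"

definition lie_abelian :: "'a::real_vector set \<Rightarrow> ('a \<Rightarrow> 'a \<Rightarrow> 'a) \<Rightarrow> bool" where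
  "lie_abelian L br \<longleftrightarrow> (\<forall>x\<in>L. \<forall>y\<in>L. br x y = 0)"

definition lie_ideal ::
    "'a::real_vector set \<Rightarrow> ('a \<Rightarrow> 'a \<Rightarrow> 'a) \<Rightarrow> 'a set \<Rightarrow> bool" where
  "lie_ideal L br K \<longleftrightarrow> subspace K \<and> K \<subseteq> L \<and> (\<forall>x\<in>L. \<forall>y\<in>K. br x y \<in> K)"

definition codim_one_ideal ::
    "'a::real_vector set \<Rightarrow> ('a \<Rightarrow> 'a \<Rightarrow> 'a) \<Rightarrow> 'a set \<Rightarrow> bool" where
  "codim_one_ideal L br K \<longleftrightarrow> lie_ideal L br K \<and> dim L = dim K + 1"

definition almost_abelian :: "'a::real_vector set \<Rightarrow> ('a \<Rightarrow> 'a \<Rightarrow> 'a) \<Rightarrow> bool" where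
  "almost_abelian L br \<longleftrightarrow> (\<exists>U. codim_one_ideal L br U \<and> lie_abelian U br)"

text \<open>The decomposition \<open>L = \<real> e \<ltimes>\<^sub>M U\<close> with \<open>U\<close> abelian; \<open>M\<close> is only constrained on \<open>U\<close>.\<close>

definition almost_abelian_decomp ::
    "'a::real_vector set \<Rightarrow> ('a \<Rightarrow> 'a \<Rightarrow> 'a) \<Rightarrow> 'a \<Rightarrow> ('a \<Rightarrow> 'a) \<Rightarrow> 'a set \<Rightarrow> bool" where
  "almost_abelian_decomp L br e M U \<longleftrightarrow>
     codim_one_ideal L br U \<and> lie_abelian U br \<and>
     e \<in> L \<and> e \<notin> U \<and> (\<forall>x\<in>U. M x = br e x)"

text \<open>
  The trace of an endomorphism of a finite-dimensional space \<open>L\<close>: the sum of the diagonal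
  coefficients in a basis of \<open>L\<close>. The value does not depend on the basis selected.
\<close>

definition trace_on :: "'a::real_vector set \<Rightarrow> ('a \<Rightarrow> 'a) \<Rightarrow> real" where
  "trace_on L f =
     (let B = (SOME B. independent B \<and> span B = L) in \<Sum>b\<in>B. representation B (f b) b)"

definition unimodular :: "'a::real_vector set \<Rightarrow> ('a \<Rightarrow> 'a \<Rightarrow> 'a) \<Rightarrow> bool" where
  "unimodular L br \<longleftrightarrow> (\<forall>y\<in>L. trace_on L (\<lambda>x. br y x) = 0)"

definition inner_product_on :: "'a::real_vector set \<Rightarrow> ('a \<Rightarrow> 'a \<Rightarrow> real) \<Rightarrow> bool" where
  "inner_product_on L ip \<longleftrightarrow>
     bilinear_map_on L UNIV ip \<and>
     (\<forall>x\<in>L. \<forall>y\<in>L. ip x y = ip y x) \<and>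
     (\<forall>x\<in>L. x \<noteq> 0 \<longrightarrow> ip x x > 0)"

text \<open>The Chevalley--Eilenberg differential (trivial coefficients) of 1-forms and of 2-forms.\<close>

definition ce_d1 :: "('a \<Rightarrow> 'a \<Rightarrow> 'a) \<Rightarrow> ('a \<Rightarrow> real) \<Rightarrow> 'a \<Rightarrow> 'a \<Rightarrow> real" where
  "ce_d1 br \<alpha> x y = - \<alpha> (br x y)"

definition ce_d2 :: "('a \<Rightarrow> 'a \<Rightarrow> 'a) \<Rightarrow> ('a \<Rightarrow> 'a \<Rightarrow> real) \<Rightarrow> 'a \<Rightarrow> 'a \<Rightarrow> 'a \<Rightarrow> real" where
  "ce_d2 br \<omega> x y z = - \<omega> (br x y) z + \<omega> (br x z) y - \<omega> (br y z) x"

definition nijenhuis ::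
    "('a::real_vector \<Rightarrow> 'a \<Rightarrow> 'a) \<Rightarrow> ('a \<Rightarrow> 'a) \<Rightarrow> 'a \<Rightarrow> 'a \<Rightarrow> 'a" where
  "nijenhuis br J x y = br (J x) (J y) - J (br (J x) y) - J (br x (J y)) + J (J (br x y))"

definition fundamental_form :: "('a \<Rightarrow> 'a) \<Rightarrow> ('a \<Rightarrow> 'a \<Rightarrow> real) \<Rightarrow> 'a \<Rightarrow> 'a \<Rightarrow> real" where
  "fundamental_form J ip x y = ip (J x) y"

definition kahler_structure ::
    "'a::real_vector set \<Rightarrow> ('a \<Rightarrow> 'a \<Rightarrow> 'a) \<Rightarrow> ('a \<Rightarrow> 'a) \<Rightarrow> ('a \<Rightarrow> 'a \<Rightarrow> real) \<Rightarrow> bool" where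
  "kahler_structure L br J ip \<longleftrightarrow>
     linear_map_on L L J \<and> inner_product_on L ip \<and>
     (\<forall>x\<in>L. J (J x) = - x) \<and>
     (\<forall>x\<in>L. \<forall>y\<in>L. ip (J x) (J y) = ip x y) \<and>
     (\<forall>x\<in>L. \<forall>y\<in>L. nijenhuis br J x y = 0) \<and>
     (\<forall>x\<in>L. \<forall>y\<in>L. \<forall>z\<in>L. ce_d2 br (fundamental_form J ip) x y z = 0)"

definition cokahler_structure ::
    "'a::real_vector set \<Rightarrow> ('a \<Rightarrow> 'a \<Rightarrow> 'a) \<Rightarrow> 'a \<Rightarrow> ('a \<Rightarrow> 'a) \<Rightarrow> ('a \<Rightarrow> real) \<Rightarrow>
      ('a \<Rightarrow> 'a \<Rightarrow> real) \<Rightarrow> bool" where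
  "cokahler_structure L br \<xi> J \<alpha> ip \<longleftrightarrow>
     \<xi> \<in> L \<and> \<xi> \<noteq> 0 \<and>
     linear_map_on L L J \<and> linear_map_on L UNIV \<alpha> \<and> inner_product_on L ip \<and>
     \<alpha> \<xi> = 1 \<and>
     (\<forall>x\<in>L. J (J x) = - x + \<alpha> x *\<^sub>R \<xi>) \<and>
     (\<forall>x\<in>L. \<forall>y\<in>L. ip (J x) (J y) = ip x y - \<alpha> x * \<alpha> y) \<and>
     (\<forall>x\<in>L. \<forall>y\<in>L. ce_d1 br \<alpha> x y = 0) \<and>
     (\<forall>x\<in>L. \<forall>y\<in>L. nijenhuis br J x y = 0) \<and>
     (\<forall>x\<in>L. \<forall>y\<in>L. \<forall>z\<in>L. ce_d2 br (fundamental_form J ip) x y z = 0)"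

text \<open>
  The decomposition \<open>L = \<real> \<xi> \<ltimes>\<^sub>D H\<close> attached to a coKaehler structure: \<open>H = ker \<alpha>\<close> and
  \<open>D\<close> is the restriction of \<open>ad \<xi>\<close> to \<open>H\<close>. That \<open>H\<close> is an ideal equal to the orthogonal
  complement of \<open>\<xi>\<close>, Kaehler for the restricted structure, and that \<open>D\<close> is a skew-symmetric
  derivation commuting with \<open>J\<close>, are consequences and are not imposed here.
\<close>

definition cokahler_decomp ::
    "'a::real_vector set \<Rightarrow> ('a \<Rightarrow> 'a \<Rightarrow> 'a) \<Rightarrow> 'a \<Rightarrow> ('a \<Rightarrow> real) \<Rightarrow> ('a \<Rightarrow> 'a) \<Rightarrow> 'a set \<Rightarrow> bool"
  where
  "cokahler_decomp L br \<xi> \<alpha> D H \<longleftrightarrow> H = {x \<in> L. \<alpha> x = 0} \<and> (\<forall>x\<in>H. D x = br \<xi> x)"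

definition unit_normal_in ::
    "('a::real_vector \<Rightarrow> 'a \<Rightarrow> real) \<Rightarrow> 'a set \<Rightarrow> 'a set \<Rightarrow> 'a \<Rightarrow> bool" where
  "unit_normal_in ip H W h\<^sub>0 \<longleftrightarrow> h\<^sub>0 \<in> H \<and> sqrt (ip h\<^sub>0 h\<^sub>0) = 1 \<and> (\<forall>x\<in>W. ip h\<^sub>0 x = 0)"

definition lie_isomorphism ::
    "'a::real_vector set \<Rightarrow> ('a \<Rightarrow> 'a \<Rightarrow> 'a) \<Rightarrow> 'b::real_vector set \<Rightarrow> ('b \<Rightarrow> 'b \<Rightarrow> 'b) \<Rightarrow>
      ('a \<Rightarrow> 'b) \<Rightarrow> bool" where
  "lie_isomorphism L br L' br' \<phi> \<longleftrightarrow>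
     linear_map_on L L' \<phi> \<and> bij_betw \<phi> L L' \<and>
     (\<forall>x\<in>L. \<forall>y\<in>L. \<phi> (br x y) = br' (\<phi> x) (\<phi> y))"

definition product_bracket ::
    "('a \<Rightarrow> 'a \<Rightarrow> 'a) \<Rightarrow> ('b \<Rightarrow> 'b \<Rightarrow> 'b) \<Rightarrow> 'a \<times> 'b \<Rightarrow> 'a \<times> 'b \<Rightarrow> 'a \<times> 'b" where
  "product_bracket br br' p q = (br (fst p) (fst q), br' (snd p) (snd q))"

end

theory Submission
  imports Defs
begin

text \<open>
  Write \<open>h\<close> for the unit normal of \<open>\<hh> \<inter> \<uu>\<close> in \<open>\<hh>\<close>. The linear form \<open>y \<mapsto> tr (ad y)\<close> vanishes on
  \<open>\<uu>\<close>, since there \<open>ad y\<close> has rank at most one and image in its kernel, and on \<open>\<xi>\<close>, since \<open>ad \<xi>\<close> is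
  skew-symmetric. So unimodularity depends on \<open>tr (ad h)\<close> alone. The vanishing of
  \<open>d\<omega>\<close> and of the Nijenhuis tensor gives \<open>[h, Jh] = a Jh\<close> and makes \<open>ad h\<close> skew-symmetric on the orthogonal
  complement of \<open>h\<close>, \<open>Jh\<close> in \<open>\<hh>\<close>; hence \<open>tr (ad h) = a\<close>. If \<open>a \<noteq> 0\<close>, then \<open>\<xi> \<in> \<uu>\<close>, because otherwise
  \<open>\<xi>\<close> and \<open>\<uu>\<close> span the algebra; and \<open>\<xi> \<in> \<uu>\<close> forces \<open>D = 0\<close>.
\<close>

section \<open>Finite-dimensional linear algebra by counting independent sets\<close>

lemma linear_map_on_UNIV_iff: "linear_map_on UNIV UNIV f \<longleftrightarrow> linear f"
  by (auto simp: linear_map_on_def intro: linearI linear_add linear_scale)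

lemma bilinear_map_on_UNIV_iff: "bilinear_map_on UNIV UNIV f \<longleftrightarrow> bilinear f"
  by (simp add: bilinear_map_on_def bilinear_def linear_map_on_UNIV_iff)

lemma subspace_imp_finite_span:
  fixes W :: "'a::real_vector set"
  assumes "subspace W" "W \<subseteq> span S" "finite S"
  obtains B where "finite B" "independent B" "span B = W"
proof -
  obtain B where B: "B \<subseteq> W" "independent B" "W \<subseteq> span B"
    using maximal_independent_subset by blast
  moreover have "finite B"
    using independent_span_bound[OF assms(3) B(2)] B(1) assms(2) by blast
  moreover have "span B = W"
    using B assms(1) by (metis span_subspace)
  ultimately show thesis using that by blast
qed

text \<open>A vector \<open>x\<close> outside the span of \<open>e\<close> and a basis of
  \<open>U\<close> would give an independent set of \<open>dim U + 2\<close> vectors inside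
  \<open>V\<close>.\<close>

lemma codim_one_complement:
  fixes U V :: "'a::real_vector set"
  assumes fin: "finite S" "V \<subseteq> span S" and sub: "subspace U" "subspace V" "U \<subseteq> V"
    and dim: "dim V = dim U + 1" and e: "e \<in> V" "e \<notin> U" and x: "x \<in> V"
  obtains c where "x - c *\<^sub>R e \<in> U"
proof -
  obtain B where B: "finite B" "independent B" "span B = U"
    using subspace_imp_finite_span sub fin by (metis order_trans)
  obtain C where C: "finite C" "independent C" "span C = V"
    using subspace_imp_finite_span sub fin by metis
  have dims: "dim U = card B" "dim V = card C"
    using B C by (metis dim_span dim_eq_card_independent)+
  have ind: "independent (insert e B)"
    using B e by (simp add: independent_insert)
  have "x \<in> span (insert e B)"
  proof (rule ccontr)
    assume n: "x \<notin> span (insert e B)"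
    then have "independent (insert x (insert e B))"
      using ind by (simp add: independent_insert)
    moreover have "insert x (insert e B) \<subseteq> span C"
      using C B x e sub span_superset[of B] by blast
    ultimately have "card (insert x (insert e B)) \<le> card C"
      using independent_span_bound[OF C(1)] by blast
    moreover have "x \<notin> insert e B" "e \<notin> B"
      using n B(3) e(2) by (auto simp: span_base)
    ultimately show False using dims dim B by simp
  qed
  then show thesis using that B(3) by (auto simp: span_insert)
qed

text \<open>Converse of \<open>codim_one_complement\<close>: adjoining \<open>e\<close> to a basis
  of \<open>U\<close> gives a basis of \<open>V\<close>.\<close>

lemma dim_insert_complement:
  fixes U V :: "'a::real_vector set"
  assumes fin: "finite S" "V \<subseteq> span S" and sub: "subspace U" "subspace V" "U \<subseteq> V"
    and e: "e \<in> V" "e \<notin> U" and c: "\<And>x. x \<in> V \<Longrightarrow> \<exists>c. x - c *\<^sub>R e \<in> U"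
  shows "dim V = dim U + 1"
proof -
  obtain B where B: "finite B" "independent B" "span B = U"
    using subspace_imp_finite_span sub fin by (metis order_trans)
  have ind: "independent (insert e B)"
    using B e by (simp add: independent_insert)
  have "span (insert e B) = V"
  proof
    show "span (insert e B) \<subseteq> V"
      using B e sub span_superset[of B] by (intro span_minimal) auto
    show "V \<subseteq> span (insert e B)"
      using B c by (auto simp: span_insert)
  qed
  then have "dim V = card (insert e B)"
    using ind by (metis dim_span dim_eq_card_independent)
  moreover have "dim U = card B" using B by (metis dim_span dim_eq_card_independent)
  moreover have "e \<notin> B" using B(3) e(2) by (auto simp: span_base)
  ultimately show ?thesis using B by simp
qed

section \<open>Inner products and reproducing frames\<close>

locale inner_form =
  fixes ip :: "'a::real_vector \<Rightarrow> 'a \<Rightarrow> real"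
  assumes ip: "inner_product_on UNIV ip"
begin

lemma bilinear_ip: "bilinear ip"
  using ip by (simp add: inner_product_on_def bilinear_map_on_UNIV_iff)

lemmas ip_simps = bilinear_ladd[OF bilinear_ip] bilinear_radd[OF bilinear_ip]
  bilinear_lmul[OF bilinear_ip] bilinear_rmul[OF bilinear_ip]
  bilinear_lsub[OF bilinear_ip] bilinear_rsub[OF bilinear_ip]
  bilinear_lneg[OF bilinear_ip] bilinear_rneg[OF bilinear_ip]
  bilinear_lzero[OF bilinear_ip] bilinear_rzero[OF bilinear_ip]

lemma ip_sym: "ip x y = ip y x"
  using ip by (simp add: inner_product_on_def)

lemma ip_pos: "x \<noteq> 0 \<Longrightarrow> ip x x > 0"
  using ip by (simp add: inner_product_on_def)

lemma ip_self_zeroD: "ip x x = 0 \<Longrightarrow> x = 0"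
  using ip_pos[of x] by fastforce

lemma linear_ip_left: "linear (\<lambda>x. ip x y)"
  using bilinear_ip by (simp add: bilinear_def)

lemma ip_sum_left: "ip (\<Sum>e\<in>E. f e) y = (\<Sum>e\<in>E. ip (f e) y)"
  using linear_sum[OF linear_ip_left] .

lemma ip_sum_right: "ip y (\<Sum>e\<in>E. f e) = (\<Sum>e\<in>E. ip y (f e))"
  using ip_sum_left by (simp add: ip_sym[of y])

text \<open>The coefficients can be moved from \<open>b\<close> to \<open>y\<close>, and the frame
  reproduces \<open>y\<close>. If \<open>W\<close> is a subspace containing \<open>E\<close>, the
  sum is the orthogonal projection of \<open>b\<close> to \<open>W\<close>.\<close>

lemma orthogonal_residue:
  assumes "\<And>x. x \<in> W \<Longrightarrow> x = (\<Sum>e\<in>E. ip x e *\<^sub>R e)" and "y \<in> W"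
  shows "ip (b - (\<Sum>e\<in>E. ip b e *\<^sub>R e)) y = 0"
proof -
  have "ip (\<Sum>e\<in>E. ip b e *\<^sub>R e) y = ip b (\<Sum>e\<in>E. ip y e *\<^sub>R e)"
    by (simp add: ip_sum_left ip_sum_right ip_simps ip_sym[of y] mult.commute)
  also have "\<dots> = ip b y"
    using assms by metis
  finally show ?thesis by (simp add: ip_simps)
qed

lemma ex_unit_multiple:
  assumes "b \<noteq> 0"
  obtains k where "k \<noteq> 0" "ip (k *\<^sub>R b) (k *\<^sub>R b) = 1"
proof (rule that)
  show "1 / sqrt (ip b b) \<noteq> 0" using ip_pos[OF assms] by simp
  show "ip ((1 / sqrt (ip b b)) *\<^sub>R b) ((1 / sqrt (ip b b)) *\<^sub>R b) = 1"
    using ip_pos[OF assms] by (simp add: ip_simps)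
qed

text \<open>The reproducing identity replaces an orthonormal basis: it suffices for computing traces,
  and orthonormality need not be carried through the induction.\<close>

lemma ex_frame:
  assumes "finite B"
  shows "\<exists>E. finite E \<and> E \<subseteq> span B \<and> (\<forall>x\<in>span B. x = (\<Sum>e\<in>E. ip x e *\<^sub>R e))"
  using assms
proof (induction B)
  case empty
  then show ?case by (intro exI[of _ "{}"]) simp
next
  case (insert b B)
  then obtain E where E: "finite E" "E \<subseteq> span B"
    "\<And>x. x \<in> span B \<Longrightarrow> x = (\<Sum>e\<in>E. ip x e *\<^sub>R e)" by auto
  define p where "p = (\<Sum>e\<in>E. ip b e *\<^sub>R e)"
  have p: "p \<in> span B"
    unfolding p_def using E(2) by (intro span_sum span_scale) auto
  have orth: "ip (b - p) y = 0" if "y \<in> span B" for y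
    unfolding p_def by (rule orthogonal_residue[OF E(3) that])
  have sub: "span B \<subseteq> span (insert b B)" by (simp add: span_mono subset_insertI)
  show ?case
  \<comment> \<open>Gram-Schmidt: either \<open>b\<close> is already in the old span and
    \<open>E\<close> still works, or the normalized residue of \<open>b\<close> is adjoined.\<close>
  proof (cases "b = p")
    case True
    then show ?thesis using p E by (metis insert_absorb span_redundant)
  next
    case False
    then obtain k where k: "k \<noteq> 0" "ip (k *\<^sub>R (b - p)) (k *\<^sub>R (b - p)) = 1"
      using ex_unit_multiple[of "b - p"] by auto
    define u where "u = k *\<^sub>R (b - p)"
    have uu: "ip u u = 1" using k by (simp add: u_def)
    have uo: "ip u y = 0" if "y \<in> span B" for y
      using orth[OF that] by (simp add: u_def ip_simps)
    have uE: "u \<notin> E" using uo uu E(2) by force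
    have uspan: "u \<in> span (insert b B)"
      unfolding u_def using p sub by (intro span_scale span_diff) (auto simp: span_base)
    have "x = (\<Sum>e\<in>insert u E. ip x e *\<^sub>R e)" if x: "x \<in> span (insert b B)" for x
    proof -
      obtain t where t: "x - t *\<^sub>R b \<in> span B" using x by (auto simp: span_insert)
      \<comment> \<open>As \<open>u\<close> is \<open>k\<close> times \<open>b - p\<close>,
        subtracting \<open>t / k\<close> times \<open>u\<close> trades \<open>t\<close> times
        \<open>b\<close> for \<open>t\<close> times \<open>p\<close>, which lies in the old
        span.\<close>
      define y where "y = x - (t / k) *\<^sub>R u"
      have "y = (x - t *\<^sub>R b) + t *\<^sub>R p"
        using k by (simp add: y_def u_def algebra_simps)
      then have y: "y \<in> span B" using t p by (simp add: span_add span_scale)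
      have xy: "x = y + (t / k) *\<^sub>R u" by (simp add: y_def)
      have "ip x u = t / k" using uo[OF y] uu by (simp add: xy ip_simps ip_sym[of y])
      moreover have "ip x e = ip y e" if "e \<in> E" for e
        using that uo E(2) by (auto simp: xy ip_simps)
      ultimately have "(\<Sum>e\<in>insert u E. ip x e *\<^sub>R e) = (t / k) *\<^sub>R u + (\<Sum>e\<in>E. ip y e *\<^sub>R e)"
        using E(1) uE by simp
      then show ?thesis using E(3)[OF y] xy by (simp add: add.commute)
    qed
    then show ?thesis
      using E uspan sub by (intro exI[of _ "insert u E"]) blast
  qed
qed

end

section \<open>Traces of rank-one and of skew-symmetric maps\<close>

text \<open>One basis serves for all \<open>f\<close>, because the choice in \<open>trace_on\<close> depends on \<open>L\<close> only; the
  independence of the trace from the basis is therefore never needed.\<close>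

lemma trace_on_basis:
  fixes L :: "'a::real_vector set"
  assumes "finite S" "L = span S"
  obtains B where "finite B" "independent B" "span B = L"
    "\<And>f. trace_on L f = (\<Sum>b\<in>B. representation B (f b) b)"
proof -
  define B where "B = (SOME B. independent B \<and> span B = L)"
  have "\<exists>B. independent B \<and> span B = L"
    using subspace_imp_finite_span[of L S] assms by (metis subspace_span order_refl)
  then have B: "independent B \<and> span B = L"
    unfolding B_def by (rule someI_ex)
  moreover have "finite B"
    using independent_span_bound[OF assms(1)] B assms(2) span_superset by metis
  ultimately show thesis
    using that[of B] by (simp add: trace_on_def B_def[symmetric] Let_def)
qed

lemma trace_on_add:
  assumes "finite S" "L = span S" "f ` L \<subseteq> L" "g ` L \<subseteq> L"
  shows "trace_on L (\<lambda>x. f x + g x) = trace_on L f + trace_on L g"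
proof -
  obtain B where B: "independent B" "span B = L"
    "\<And>f. trace_on L f = (\<Sum>b\<in>B. representation B (f b) b)"
    using trace_on_basis[OF assms(1,2)] by metis
  have "b \<in> L" if "b \<in> B" for b using that B(2) span_base by blast
  then show ?thesis
    unfolding B(3) sum.distrib[symmetric] using B assms(3,4)
    by (intro sum.cong refl) (simp add: representation_add image_subset_iff)
qed

lemma trace_on_scale:
  assumes "finite S" "L = span S" "f ` L \<subseteq> L"
  shows "trace_on L (\<lambda>x. c *\<^sub>R f x) = c * trace_on L f"
proof -
  obtain B where B: "independent B" "span B = L"
    "\<And>f. trace_on L f = (\<Sum>b\<in>B. representation B (f b) b)"
    using trace_on_basis[OF assms(1,2)] by metis
  have "b \<in> L" if "b \<in> B" for b using that B(2) span_base by blast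
  then show ?thesis
    unfolding B(3) sum_distrib_left using B assms(3)
    by (intro sum.cong refl) (simp add: representation_scale image_subset_iff)
qed

lemma trace_on_cong:
  assumes "finite S" "L = span S" "\<And>x. x \<in> L \<Longrightarrow> f x = g x"
  shows "trace_on L f = trace_on L g"
proof -
  obtain B where B: "span B = L"
    "\<And>f. trace_on L f = (\<Sum>b\<in>B. representation B (f b) b)"
    using trace_on_basis[OF assms(1,2)] by metis
  show ?thesis
    unfolding B(2) using B(1) assms(3) by (intro sum.cong refl) (auto simp: span_base)
qed

text \<open>The diagonal coefficient at \<open>b\<close> is \<open>\<phi> b\<close> times the
  coordinate of \<open>v\<close> along \<open>b\<close>; these sum to \<open>\<phi>\<close> of the
  expansion of \<open>v\<close>.\<close>

lemma trace_on_rank_one: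
  assumes "finite S" "L = span S" "linear \<phi>" "v \<in> L"
  shows "trace_on L (\<lambda>x. \<phi> x *\<^sub>R v) = \<phi> v"
proof -
  obtain B where B: "finite B" "independent B" "span B = L"
    "\<And>f. trace_on L f = (\<Sum>b\<in>B. representation B (f b) b)"
    using trace_on_basis[OF assms(1,2)] by metis
  have "\<phi> v = \<phi> (\<Sum>b\<in>B. representation B v b *\<^sub>R b)"
    using sum_representation_eq[of B v B] B assms(4) by simp
  also have "\<dots> = (\<Sum>b\<in>B. representation B v b * \<phi> b)"
    using assms(3) by (simp add: linear_sum linear_scale)
  also have "\<dots> = trace_on L (\<lambda>x. \<phi> x *\<^sub>R v)"
    using B assms(4) by (simp add: representation_scale mult.commute)
  finally show ?thesis ..
qed

lemma trace_on_sum: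
  assumes "finite S" "L = span S" "finite E" "\<And>e. e \<in> E \<Longrightarrow> f e ` L \<subseteq> L"
  shows "trace_on L (\<lambda>x. \<Sum>e\<in>E. f e x) = (\<Sum>e\<in>E. trace_on L (f e))"
  using assms(3,4)
proof (induction E)
  case empty
  \<comment> \<open>The zero map is written as \<open>0\<close> times the identity so that
    homogeneity of the trace applies.\<close>
  have "trace_on L (\<lambda>x. 0 *\<^sub>R x) = 0"
    by (subst trace_on_scale[OF assms(1,2)]) auto
  then show ?case by simp
next
  case (insert e E)
  have "(\<lambda>x. \<Sum>e\<in>E. f e x) ` L \<subseteq> L"
    using insert.prems assms(2) by (auto intro!: span_sum)
  then show ?case
    using insert trace_on_add[OF assms(1,2), of "f e" "\<lambda>x. \<Sum>e\<in>E. f e x"] by simp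
qed

text \<open>A frame writes \<open>f\<close> as a sum of rank-one maps with traces
  \<open>ip (f e) e\<close>, each of which vanishes.\<close>

lemma (in inner_form) trace_on_skew:
  assumes "finite S" "L = span S" "linear f" "f ` L \<subseteq> L" "\<And>x. x \<in> L \<Longrightarrow> ip (f x) x = 0"
  shows "trace_on L f = 0"
proof -
  obtain E where E: "finite E" "E \<subseteq> L" "\<And>x. x \<in> L \<Longrightarrow> x = (\<Sum>e\<in>E. ip x e *\<^sub>R e)"
    using ex_frame[OF assms(1)] assms(2) by metis
  have "f x = (\<Sum>e\<in>E. ip x e *\<^sub>R f e)" if "x \<in> L" for x
    by (subst E(3)[OF that]) (simp add: linear_sum[OF assms(3)] linear_scale[OF assms(3)])
  then have "trace_on L f = trace_on L (\<lambda>x. \<Sum>e\<in>E. ip x e *\<^sub>R f e)"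
    by (rule trace_on_cong[OF assms(1,2)])
  also have "\<dots> = (\<Sum>e\<in>E. trace_on L (\<lambda>x. ip x e *\<^sub>R f e))"
    using E assms(2,4) by (intro trace_on_sum[OF assms(1,2)]) (auto intro!: span_scale)
  also have "\<dots> = (\<Sum>e\<in>E. ip (f e) e)"
    using E(2) assms(4)
    by (intro sum.cong refl trace_on_rank_one[OF assms(1,2)] linear_ip_left) auto
  also have "\<dots> = 0" using E(2) assms(5) by (simp add: subset_iff)
  finally show ?thesis .
qed

section \<open>Identities of a coKaehler structure\<close>

locale cokahler_lie_algebra = inner_form ip
  for ip :: "'a::real_vector \<Rightarrow> 'a \<Rightarrow> real" +
  fixes br :: "'a \<Rightarrow> 'a \<Rightarrow> 'a" and \<xi> :: 'a and J :: "'a \<Rightarrow> 'a" and \<alpha> :: "'a \<Rightarrow> real"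
  assumes lie: "lie_algebra_on UNIV br"
    and cokahler: "cokahler_structure UNIV br \<xi> J \<alpha> ip"
begin

lemma bilinear_br: "bilinear br"
  using lie by (simp add: lie_algebra_on_def bilinear_map_on_UNIV_iff)

lemma linear_br_right: "linear (br x)"
  using bilinear_br by (simp add: bilinear_def)

lemmas br_simps = bilinear_ladd[OF bilinear_br] bilinear_radd[OF bilinear_br]
  bilinear_lmul[OF bilinear_br] bilinear_rmul[OF bilinear_br]
  bilinear_lsub[OF bilinear_br] bilinear_rsub[OF bilinear_br]
  bilinear_lneg[OF bilinear_br] bilinear_rneg[OF bilinear_br]
  bilinear_lzero[OF bilinear_br] bilinear_rzero[OF bilinear_br]

lemma br_self [simp]: "br x x = 0"
  using lie by (simp add: lie_algebra_on_def)

lemma br_swap: "br x y = - br y x"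
proof -
  have "br x y + br y x = 0"
    using br_self[of "x + y"] unfolding br_simps by (simp add: add.commute)
  then show ?thesis by (simp add: eq_neg_iff_add_eq_0)
qed

lemma linear_J: "linear J" and linear_\<alpha>: "linear \<alpha>"
  using cokahler by (simp_all add: cokahler_structure_def linear_map_on_UNIV_iff)

lemmas J_simps = linear_add[OF linear_J] linear_scale[OF linear_J] linear_diff[OF linear_J]
  linear_neg[OF linear_J] linear_0[OF linear_J]

lemmas \<alpha>_simps = linear_add[OF linear_\<alpha>] linear_scale[OF linear_\<alpha>] linear_diff[OF linear_\<alpha>]
  linear_neg[OF linear_\<alpha>] linear_0[OF linear_\<alpha>]

lemma \<alpha>_\<xi> [simp]: "\<alpha> \<xi> = 1"
  and J_J: "J (J x) = - x + \<alpha> x *\<^sub>R \<xi>"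
  and ip_J_J: "ip (J x) (J y) = ip x y - \<alpha> x * \<alpha> y"
  and \<alpha>_br [simp]: "\<alpha> (br x y) = 0"
  using cokahler by (simp_all add: cokahler_structure_def ce_d1_def)

lemma nijenhuis_zero: "br (J x) (J y) - J (br (J x) y) - J (br x (J y)) + J (J (br x y)) = 0"
  using cokahler unfolding cokahler_structure_def nijenhuis_def by blast

lemma d_omega_zero: "- ip (J (br x y)) z + ip (J (br x z)) y - ip (J (br y z)) x = 0"
  using cokahler by (simp add: cokahler_structure_def ce_d2_def fundamental_form_def)

text \<open>\<open>J (J \<xi>) = 0\<close> makes \<open>J \<xi>\<close> a multiple of
  \<open>\<xi>\<close>; applying \<open>J\<close> once more, either the factor or
  \<open>J \<xi>\<close> is zero.\<close>

lemma J_\<xi> [simp]: "J \<xi> = 0"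
proof -
  have JJ: "J (J \<xi>) = 0" by (simp add: J_J)
  then have J\<xi>: "J \<xi> = \<alpha> (J \<xi>) *\<^sub>R \<xi>"
    using J_J[of "J \<xi>"] by (simp add: J_simps)
  have "0 = \<alpha> (J \<xi>) *\<^sub>R J \<xi>"
    using arg_cong[OF J\<xi>, of J] JJ by (simp add: J_simps)
  then show ?thesis using J\<xi> by auto
qed

text \<open>Computing \<open>J (J (J x))\<close> from the inside and from the outside differs by
  \<open>\<alpha> (J x)\<close> times \<open>\<xi>\<close>.\<close>

lemma \<alpha>_J [simp]: "\<alpha> (J x) = 0"
proof -
  have "J (J (J x)) = - J x"
    unfolding J_J[of x] by (simp add: J_simps)
  then have "\<alpha> (J x) *\<^sub>R \<xi> = 0" using J_J[of "J x"] by simp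
  moreover have "\<xi> \<noteq> 0" using \<alpha>_\<xi> \<alpha>_simps(5) by force
  ultimately show ?thesis by simp
qed

text \<open>The metric identifies \<open>\<alpha>\<close> with \<open>\<xi>\<close>, so the kernel
  of \<open>\<alpha>\<close> is the orthogonal complement of \<open>\<xi>\<close>.\<close>

lemma ip_\<xi>: "ip x \<xi> = \<alpha> x"
  using ip_J_J[of x \<xi>] by (simp add: ip_simps)

lemma J_J_ker: "\<alpha> x = 0 \<Longrightarrow> J (J x) = - x"
  by (simp add: J_J)

lemma ip_J_swap: "\<alpha> x = 0 \<Longrightarrow> ip (J x) y = - ip x (J y)"
  using ip_J_J[of x "J y"] by (simp add: J_J ip_simps ip_\<xi> ip_J_J)

lemma ip_J_self: "ip (J x) x = 0"
proof -
  have "ip (J x) x = ip (J (J x)) (J x)" using ip_J_J[of "J x" x] by simp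
  also have "\<dots> = - ip x (J x)" by (simp add: J_J ip_simps ip_\<xi> ip_sym[of \<xi>])
  finally show ?thesis by (simp add: ip_sym)
qed

text \<open>The terms with \<open>J \<xi>\<close> drop out of the Nijenhuis tensor at
  \<open>\<xi>\<close> and \<open>J y\<close>.\<close>

lemma br_\<xi>_J: "\<alpha> y = 0 \<Longrightarrow> br \<xi> (J y) = J (br \<xi> y)"
  using nijenhuis_zero[of \<xi> "J y"] by (simp add: br_simps J_J_ker J_simps)

text \<open>Closedness of the fundamental form at \<open>\<xi>\<close>, \<open>w\<close>,
  \<open>z\<close> says that \<open>br \<xi>\<close> preserves it infinitesimally; since
  \<open>br \<xi>\<close> commutes with \<open>J\<close>, it is skew for the metric too. The vector
  \<open>w\<close> is chosen with \<open>J w = y\<close>.\<close>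

lemma br_\<xi>_skew:
  assumes "\<alpha> y = 0" "\<alpha> z = 0"
  shows "ip (br \<xi> y) z = - ip y (br \<xi> z)"
proof -
  define w where "w = - J y"
  have w: "\<alpha> w = 0" "J w = y"
    using assms by (simp_all add: w_def \<alpha>_simps J_simps J_J_ker)
  have "ip (J (br \<xi> w)) z = ip (J (br \<xi> z)) w"
    using d_omega_zero[of \<xi> w z] by (simp add: ip_\<xi>)
  also have "ip (J (br \<xi> z)) w = - ip (br \<xi> z) y" using w by (simp add: ip_J_swap)
  finally show ?thesis using br_\<xi>_J[OF w(1)] w(2) ip_sym[of y] by simp
qed

text \<open>Skewness extends from the kernel of \<open>\<alpha>\<close> to the whole algebra:
  \<open>br \<xi>\<close> kills \<open>\<xi>\<close>, and its image is orthogonal to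
  \<open>\<xi>\<close>.\<close>

lemma ip_br_\<xi>_self: "ip (br \<xi> x) x = 0"
proof -
  define y where "y = x - \<alpha> x *\<^sub>R \<xi>"
  have y: "\<alpha> y = 0" by (simp add: y_def \<alpha>_simps)
  have "br \<xi> x = br \<xi> y" by (simp add: y_def br_simps)
  then have "ip (br \<xi> x) x = ip (br \<xi> y) y"
    by (simp add: y_def ip_simps ip_\<xi>)
  then show ?thesis using br_\<xi>_skew[OF y y] ip_sym[of y "br \<xi> y"] by linarith
qed

definition ker_\<alpha> :: "'a set" where "ker_\<alpha> = {x. \<alpha> x = 0}"

lemma subspace_ker_\<alpha>: "subspace ker_\<alpha>"
  by (auto simp: ker_\<alpha>_def subspace_def \<alpha>_simps)

lemma ex_finite_span_UNIV: "\<exists>S. finite S \<and> span S = (UNIV :: 'a set)"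
  using lie by (auto simp: lie_algebra_on_def)

lemma subspace_finite_span:
  assumes "subspace (W :: 'a set)"
  obtains B where "finite B" "W = span B"
  using ex_finite_span_UNIV subspace_imp_finite_span[OF assms] by (metis top_greatest)

lemma lie_algebra_ker_\<alpha>: "lie_algebra_on ker_\<alpha> br"
  unfolding lie_algebra_on_def
proof (intro conjI)
  show "\<exists>B. finite B \<and> ker_\<alpha> = span B" using subspace_finite_span[OF subspace_ker_\<alpha>] by metis
  show "bilinear_map_on ker_\<alpha> ker_\<alpha> br"
    by (simp add: bilinear_map_on_def linear_map_on_def ker_\<alpha>_def br_simps)
qed (use lie in \<open>simp_all add: lie_algebra_on_def\<close>)

lemma kahler_ker_\<alpha>: "kahler_structure ker_\<alpha> br J ip"
  unfolding kahler_structure_def linear_map_on_def inner_product_on_def bilinear_map_on_def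
    nijenhuis_def ce_d2_def fundamental_form_def
  using d_omega_zero nijenhuis_zero
  by (auto simp: ker_\<alpha>_def J_J_ker ip_J_J J_simps ip_simps ip_pos ip_sym)

section \<open>The trace form, and splitting off a central \<open>\<xi>\<close>\<close>

definition tr_ad :: "'a \<Rightarrow> real" where "tr_ad y = trace_on UNIV (br y)"

lemma unimodular_iff: "unimodular UNIV br \<longleftrightarrow> (\<forall>y. tr_ad y = 0)"
  by (simp add: unimodular_def tr_ad_def)

lemma linear_tr_ad: "linear tr_ad"
proof -
  obtain S where S: "finite S" "(UNIV :: 'a set) = span S"
    using ex_finite_span_UNIV by metis
  have "br (x + y) = (\<lambda>z. br x z + br y z)" "br (c *\<^sub>R x) = (\<lambda>z. c *\<^sub>R br x z)" for x y c
    by (simp_all add: fun_eq_iff br_simps)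
  then show ?thesis
    by (intro linearI) (simp_all add: tr_ad_def trace_on_add[OF S] trace_on_scale[OF S])
qed

lemma tr_ad_\<xi>: "tr_ad \<xi> = 0"
proof -
  obtain S where S: "finite S" "(UNIV :: 'a set) = span S"
    using ex_finite_span_UNIV by metis
  show ?thesis
    unfolding tr_ad_def
    by (rule trace_on_skew[OF S linear_br_right]) (auto simp: ip_br_\<xi>_self)
qed

text \<open>For central \<open>\<xi>\<close> the bracket sees only the components in
  \<open>ker_\<alpha>\<close>. The inverse map splits \<open>x\<close> into its orthogonal
  components, with \<open>\<alpha> x\<close> as the real coordinate.\<close>

lemma product_isomorphism:
  assumes "\<And>x. br \<xi> x = 0"
  shows "lie_isomorphism (ker_\<alpha> \<times> (UNIV :: real set)) (product_bracket br (\<lambda>s t. 0)) UNIV br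
         (\<lambda>(x, t). x + t *\<^sub>R \<xi>)"
  unfolding lie_isomorphism_def
proof (intro conjI)
  show "linear_map_on (ker_\<alpha> \<times> (UNIV :: real set)) UNIV (\<lambda>(x, t). x + t *\<^sub>R \<xi>)"
    by (auto simp: linear_map_on_def algebra_simps)
  show "bij_betw (\<lambda>(x, t). x + t *\<^sub>R \<xi>) (ker_\<alpha> \<times> (UNIV :: real set)) UNIV"
    by (rule bij_betw_byWitness[where f' = "\<lambda>x. (x - \<alpha> x *\<^sub>R \<xi>, \<alpha> x)"])
      (auto simp: ker_\<alpha>_def \<alpha>_simps)
  have "br x \<xi> = 0" for x using assms br_swap[of x \<xi>] by simp
  then show "\<forall>x\<in>ker_\<alpha> \<times> (UNIV :: real set). \<forall>y\<in>ker_\<alpha> \<times> (UNIV :: real set).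
      (case product_bracket br (\<lambda>s t. 0) x y of (x, t) \<Rightarrow> x + t *\<^sub>R \<xi>) =
      br (case x of (x, t) \<Rightarrow> x + t *\<^sub>R \<xi>) (case y of (x, t) \<Rightarrow> x + t *\<^sub>R \<xi>)"
    by (auto simp: product_bracket_def br_simps assms)
qed

end

section \<open>The abelian ideal of codimension one\<close>

locale cokahler_almost_abelian = cokahler_lie_algebra +
  fixes U :: "'a set" and e\<^sub>0 :: 'a
  assumes ideal: "codim_one_ideal UNIV br U" and abelian: "lie_abelian U br" and e\<^sub>0: "e\<^sub>0 \<notin> U"
begin

lemma subspace_U: "subspace U" and br_U: "y \<in> U \<Longrightarrow> br x y \<in> U"
  and dim_U: "dim (UNIV :: 'a set) = dim U + 1"
  using ideal by (auto simp: codim_one_ideal_def lie_ideal_def)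

lemma br_U_U: "x \<in> U \<Longrightarrow> y \<in> U \<Longrightarrow> br x y = 0"
  using abelian by (simp add: lie_abelian_def)

lemma U_complement:
  assumes "e \<notin> U"
  obtains c where "x - c *\<^sub>R e \<in> U"
proof -
  obtain S where "finite S" "(UNIV :: 'a set) \<subseteq> span S"
    using ex_finite_span_UNIV by auto
  then show thesis
    using codim_one_complement[of S UNIV U e x] subspace_U dim_U assms that by auto
qed

text \<open>\<open>\<beta>\<close> is the coordinate along \<open>e\<^sub>0\<close> modulo
  \<open>U\<close>. Two different coordinates of one vector would put \<open>e\<^sub>0\<close> into
  \<open>U\<close>; this uniqueness yields linearity.\<close>

lemma ex_functional_U:
  obtains \<beta> where "linear \<beta>" "\<And>x. \<beta> x = 0 \<longleftrightarrow> x \<in> U" "\<And>x. x - \<beta> x *\<^sub>R e\<^sub>0 \<in> U"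
proof -
  have "\<forall>x. \<exists>c. x - c *\<^sub>R e\<^sub>0 \<in> U" using U_complement[OF e\<^sub>0] by blast
  then obtain \<beta> where \<beta>: "\<And>x. x - \<beta> x *\<^sub>R e\<^sub>0 \<in> U" by metis
  have uniq: "c = \<beta> x" if "x - c *\<^sub>R e\<^sub>0 \<in> U" for c x
  proof (rule ccontr)
    assume "c \<noteq> \<beta> x"
    have "(1 / (c - \<beta> x)) *\<^sub>R ((x - \<beta> x *\<^sub>R e\<^sub>0) - (x - c *\<^sub>R e\<^sub>0)) \<in> U"
      by (rule subspace_scale[OF subspace_U subspace_diff[OF subspace_U \<beta> that]])
    also have "(x - \<beta> x *\<^sub>R e\<^sub>0) - (x - c *\<^sub>R e\<^sub>0) = (c - \<beta> x) *\<^sub>R e\<^sub>0"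
      by (simp add: algebra_simps)
    finally show False using \<open>c \<noteq> \<beta> x\<close> e\<^sub>0 by simp
  qed
  have "linear \<beta>"
  proof (rule linearI)
    fix x y
    have "(x - \<beta> x *\<^sub>R e\<^sub>0) + (y - \<beta> y *\<^sub>R e\<^sub>0) \<in> U"
      using \<beta> by (intro subspace_add[OF subspace_U])
    then show "\<beta> (x + y) = \<beta> x + \<beta> y"
      by (intro uniq[symmetric]) (simp add: algebra_simps)
  next
    fix c x
    have "c *\<^sub>R (x - \<beta> x *\<^sub>R e\<^sub>0) \<in> U"
      using \<beta> by (intro subspace_scale[OF subspace_U])
    then show "\<beta> (c *\<^sub>R x) = c *\<^sub>R \<beta> x"
      by (intro uniq[symmetric]) (simp add: algebra_simps)
  qed
  moreover have "\<beta> x = 0 \<longleftrightarrow> x \<in> U" for x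
    using \<beta>[of x] uniq[of x 0] by auto
  ultimately show thesis using that \<beta> by blast
qed

lemma tr_ad_U:
  assumes y: "y \<in> U"
  shows "tr_ad y = 0"
proof -
  obtain \<beta> where \<beta>: "linear \<beta>" "\<And>x. \<beta> x = 0 \<longleftrightarrow> x \<in> U" "\<And>x. x - \<beta> x *\<^sub>R e\<^sub>0 \<in> U"
    using ex_functional_U by metis
  obtain S where S: "finite S" "(UNIV :: 'a set) = span S"
    using ex_finite_span_UNIV by metis
  have "br y = (\<lambda>x. \<beta> x *\<^sub>R br y e\<^sub>0)"
  proof
    fix x
    show "br y x = \<beta> x *\<^sub>R br y e\<^sub>0"
      using br_U_U[OF y \<beta>(3)[of x]] by (simp add: br_simps)
  qed
  then have "tr_ad y = trace_on UNIV (\<lambda>x. \<beta> x *\<^sub>R br y e\<^sub>0)"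
    unfolding tr_ad_def by (rule arg_cong)
  also have "\<dots> = \<beta> (br y e\<^sub>0)"
    by (rule trace_on_rank_one[OF S \<beta>(1)]) simp
  also have "br y e\<^sub>0 \<in> U"
    using br_U[OF y, of e\<^sub>0] br_swap[of y e\<^sub>0] subspace_neg[OF subspace_U] by simp
  then have "\<beta> (br y e\<^sub>0) = 0" using \<beta>(2) by simp
  finally show ?thesis .
qed

lemma unimodular_if_\<xi>_notin_U:
  assumes "\<xi> \<notin> U"
  shows "unimodular UNIV br"
  unfolding unimodular_iff
proof
  fix y
  obtain c where "y - c *\<^sub>R \<xi> \<in> U" using U_complement[OF assms] .
  then show "tr_ad y = 0"
    using tr_ad_U[of "y - c *\<^sub>R \<xi>"] tr_ad_\<xi>
    by (simp add: linear_diff[OF linear_tr_ad] linear_scale[OF linear_tr_ad])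
qed

lemma unimodular_if_ker_\<alpha>_eq_U:
  assumes "ker_\<alpha> = U"
  shows "unimodular UNIV br"
  using unimodular_if_\<xi>_notin_U assms by (auto simp: ker_\<alpha>_def)

text \<open>If \<open>U\<close> properly contained the hyperplane \<open>ker_\<alpha>\<close>, it
  would be the whole space and contain \<open>e\<^sub>0\<close>.\<close>

lemma ker_\<alpha>_not_subset_U:
  assumes "ker_\<alpha> \<noteq> U"
  shows "\<not> ker_\<alpha> \<subseteq> U"
proof
  assume sub: "ker_\<alpha> \<subseteq> U"
  then obtain x where x: "x \<in> U" "\<alpha> x \<noteq> 0" using assms by (auto simp: ker_\<alpha>_def)
  have "e\<^sub>0 - (\<alpha> e\<^sub>0 / \<alpha> x) *\<^sub>R x \<in> U"
    using x sub by (auto simp: ker_\<alpha>_def \<alpha>_simps)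
  moreover have "(\<alpha> e\<^sub>0 / \<alpha> x) *\<^sub>R x \<in> U" using x subspace_U by (simp add: subspace_scale)
  ultimately show False using e\<^sub>0 subspace_add[OF subspace_U] by fastforce
qed

lemma ex_unit_normal:
  assumes "ker_\<alpha> \<noteq> U"
  shows "\<exists>h. unit_normal_in ip ker_\<alpha> (ker_\<alpha> \<inter> U) h"
proof -
  obtain v where v: "v \<in> ker_\<alpha>" "v \<notin> U" using ker_\<alpha>_not_subset_U[OF assms] by blast
  have W: "subspace (ker_\<alpha> \<inter> U)" by (rule subspace_inter[OF subspace_ker_\<alpha> subspace_U])
  then obtain B where B: "finite B" "ker_\<alpha> \<inter> U = span B" using subspace_finite_span by metis
  obtain E where E: "E \<subseteq> ker_\<alpha> \<inter> U"
    "\<And>x. x \<in> ker_\<alpha> \<inter> U \<Longrightarrow> x = (\<Sum>e\<in>E. ip x e *\<^sub>R e)"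
    using ex_frame[OF B(1)] B(2) by metis
  define p where "p = (\<Sum>e\<in>E. ip v e *\<^sub>R e)"
  have p: "p \<in> ker_\<alpha> \<inter> U"
    unfolding p_def using E(1) by (intro subspace_sum subspace_scale W) auto
  have orth: "ip (v - p) y = 0" if "y \<in> ker_\<alpha> \<inter> U" for y
    unfolding p_def by (rule orthogonal_residue[OF E(2) that])
  \<comment> \<open>Equality would put \<open>v\<close> into \<open>U\<close>, since the projection
    \<open>p\<close> lies there.\<close>
  have "v - p \<noteq> 0" using v p by auto
  then obtain k where k: "ip (k *\<^sub>R (v - p)) (k *\<^sub>R (v - p)) = 1" by (rule ex_unit_multiple)
  have "k *\<^sub>R (v - p) \<in> ker_\<alpha>"
    using v p subspace_ker_\<alpha> by (intro subspace_scale subspace_diff) auto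
  then show ?thesis
    unfolding unit_normal_in_def using k orth
    by (intro exI[of _ "k *\<^sub>R (v - p)"]) (auto simp: ip_simps)
qed

end

section \<open>The action of the unit normal on the kernel of \<open>\<alpha>\<close>\<close>

locale cokahler_unit_normal = cokahler_almost_abelian +
  fixes h :: 'a
  assumes normal: "unit_normal_in ip ker_\<alpha> (ker_\<alpha> \<inter> U) h"
begin

lemma \<alpha>_h [simp]: "\<alpha> h = 0" and ip_h_h [simp]: "ip h h = 1"
  and ip_h: "\<alpha> x = 0 \<Longrightarrow> x \<in> U \<Longrightarrow> ip h x = 0"
  using normal by (auto simp: unit_normal_in_def ker_\<alpha>_def)

lemma h_notin_U: "h \<notin> U"
  using ip_h[of h] by auto

text \<open>\<open>h\<close> spans a complement of \<open>U\<close>, and pairing with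
  \<open>h\<close> determines the coefficient. Hence inside \<open>ker_\<alpha>\<close>, lying in
  \<open>U\<close> means orthogonality to \<open>h\<close>.\<close>

lemma ker_\<alpha>_split:
  assumes "\<alpha> x = 0"
  shows "x - ip x h *\<^sub>R h \<in> U"
proof -
  obtain c where c: "x - c *\<^sub>R h \<in> U" using U_complement[OF h_notin_U] .
  then have "ip h (x - c *\<^sub>R h) = 0" using assms by (intro ip_h) (auto simp: \<alpha>_simps)
  then have "ip x h = c" by (simp add: ip_simps ip_sym[of h x])
  then show ?thesis using c by simp
qed

lemma in_U_iff:
  assumes "\<alpha> x = 0"
  shows "x \<in> U \<longleftrightarrow> ip x h = 0"
  using ker_\<alpha>_split[OF assms] ip_h[OF assms] by (auto simp: ip_sym)

lemma J_h_in_U: "J h \<in> U"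
  by (simp add: in_U_iff ip_J_self)

lemma br_h_in_U: "\<alpha> x = 0 \<Longrightarrow> br h x \<in> U"
proof -
  assume "\<alpha> x = 0"
  from br_U[OF ker_\<alpha>_split[OF this], of h] show ?thesis by (simp add: br_simps)
qed

lemma ip_br_h_h: "\<alpha> x = 0 \<Longrightarrow> ip (br h x) h = 0"
  using br_h_in_U in_U_iff by simp

text \<open>Defined by an inner product; \<open>br_h_J_h\<close> shows that it is the eigenvalue of
  \<open>br h\<close> at \<open>J h\<close>.\<close>

definition a :: real where "a = ip (br h (J h)) (J h)"

text \<open>A \<open>J\<close>-invariant subspace of \<open>U\<close>: brackets of its elements with
  each other and with \<open>J h\<close> vanish, which shortens the closedness and Nijenhuis
  identities below.\<close>

definition h1 :: "'a set" where "h1 = {x. \<alpha> x = 0 \<and> ip x h = 0 \<and> ip x (J h) = 0}"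

lemma h1_subset_U: "x \<in> h1 \<Longrightarrow> x \<in> U"
  by (simp add: h1_def in_U_iff)

lemma J_h1: "x \<in> h1 \<Longrightarrow> J x \<in> h1"
  by (simp add: h1_def ip_J_swap ip_J_J)

lemma ker_\<alpha>_split_h1:
  assumes "\<alpha> x = 0"
  shows "x - ip x h *\<^sub>R h - ip x (J h) *\<^sub>R J h \<in> h1"
  using assms by (simp add: h1_def \<alpha>_simps ip_simps ip_J_self ip_J_J ip_sym[of h "J h"])

text \<open>Closedness at \<open>h\<close>, \<open>J h\<close>, \<open>J y\<close> turns the pairing
  of \<open>br h (J h)\<close> with \<open>y\<close> into \<open>ip (br h (J y)) h\<close>, which is
  zero as \<open>br h\<close> maps \<open>ker_\<alpha>\<close> into \<open>U\<close>.\<close>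

lemma br_h_J_h: "br h (J h) = a *\<^sub>R J h"
proof -
  have ort: "ip (br h (J h)) y = 0" if y: "y \<in> h1" for y
  proof -
    have z: "J y \<in> h1" "J (J y) = - y" using y J_h1 by (auto simp: h1_def J_J_ker)
    have "br (J h) (J y) = 0" using J_h_in_U h1_subset_U[OF z(1)] by (rule br_U_U)
    then have "ip (J (br h (J h))) (J y) = ip (J (br h (J y))) (J h)"
      using d_omega_zero[of h "J h" "J y"] by (simp add: J_simps ip_simps)
    then show ?thesis by (simp add: ip_J_J ip_br_h_h)
  qed
  \<comment> \<open>The residue \<open>r\<close> lies in \<open>h1\<close>, while
    \<open>br h (J h)\<close> and \<open>J h\<close> are orthogonal to \<open>h1\<close>; so
    \<open>r\<close> is orthogonal to itself.\<close>
  define r where "r = br h (J h) - a *\<^sub>R J h"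
  have "br h (J h) - ip (br h (J h)) h *\<^sub>R h - ip (br h (J h)) (J h) *\<^sub>R J h \<in> h1"
    by (rule ker_\<alpha>_split_h1) simp
  then have "r \<in> h1" by (simp add: r_def a_def ip_br_h_h)
  moreover have "ip r r = ip (br h (J h)) r - a * ip r (J h)"
    by (subst (1) r_def) (simp add: ip_simps ip_sym[of "J h" r])
  ultimately have "ip r r = 0" using ort[of r] by (simp add: h1_def)
  then show ?thesis using ip_self_zeroD by (fastforce simp: r_def)
qed

text \<open>In the Nijenhuis tensor at \<open>h\<close> and \<open>y\<close>, both brackets with
  \<open>J h\<close> vanish because \<open>U\<close> is abelian.\<close>

lemma br_h_J: "y \<in> h1 \<Longrightarrow> br h (J y) = J (br h y)"
proof -
  assume y: "y \<in> h1"
  have "br (J h) y = 0" "br (J h) (J y) = 0"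
    using br_U_U[OF J_h_in_U] h1_subset_U y J_h1 by blast+
  then have "- J (br h (J y)) = br h y"
    using nijenhuis_zero[of h y] by (simp add: J_simps J_J_ker)
  then have "J (- J (br h (J y))) = J (br h y)" by simp
  then show ?thesis by (simp add: J_simps J_J_ker)
qed

text \<open>Closedness at \<open>h\<close>, \<open>J y\<close>, \<open>y\<close> and commutation
  with \<open>J\<close> give twice the claimed quantity equal to zero.\<close>

lemma ip_br_h_skew:
  assumes y: "y \<in> h1"
  shows "ip (br h y) y = 0"
proof -
  define w where "w = - J y"
  have Jy: "J y \<in> h1" by (rule J_h1[OF y])
  have "br (J y) y = 0" using h1_subset_U y Jy br_U_U by blast
  then have "ip (J (br h (J y))) y = ip (J (br h y)) (J y)"
    using d_omega_zero[of h "J y" y] by (simp add: J_simps ip_simps)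
  moreover have "J (br h (J y)) = - br h y"
    by (simp add: br_h_J[OF y] J_J_ker)
  ultimately show ?thesis by (simp add: ip_J_J ip_simps)
qed

lemma ip_br_h_J_h:
  assumes y: "y \<in> h1"
  shows "ip (br h y) (J h) = 0"
proof -
  have "ip (br h y) (J h) = - ip (J (br h y)) h" by (simp add: ip_J_swap)
  also have "J (br h y) = br h (J y)" using br_h_J[OF y] by simp
  also have "ip \<dots> h = 0" using J_h1[OF y] by (simp add: ip_br_h_h h1_def)
  finally show ?thesis by simp
qed

text \<open>\<open>br h\<close> kills \<open>h\<close>, is skew on \<open>h1\<close> and scales
  \<open>J h\<close> by \<open>a\<close>, without cross terms. Removing one rank-one map therefore
  makes it skew.\<close>

lemma ip_br_h_self:
  assumes "\<alpha> x = 0"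
  shows "ip (br h x) x = a * (ip x (J h))\<^sup>2"
proof -
  define c y where "c = ip x (J h)" and "y = x - ip x h *\<^sub>R h - c *\<^sub>R J h"
  have y: "y \<in> h1" unfolding y_def c_def by (rule ker_\<alpha>_split_h1[OF assms])
  have x: "x = y + ip x h *\<^sub>R h + c *\<^sub>R J h" by (simp add: y_def)
  have b: "br h x = br h y + (c * a) *\<^sub>R J h"
    by (subst x) (simp add: br_simps br_h_J_h)
  have "ip (br h x) x = ip (br h x) (y + c *\<^sub>R J h)"
    using ip_br_h_h[OF assms] by (subst (2) x) (simp add: ip_simps)
  also have "\<dots> = c * c * a"
    unfolding b using y
    by (simp add: ip_simps ip_br_h_skew ip_br_h_J_h ip_sym[of "J h" y] ip_J_J h1_def)
  finally show ?thesis by (simp add: c_def power2_eq_square)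
qed

section \<open>Traces of \<open>br h\<close> and unimodularity\<close>

lemma trace_ker_\<alpha>_ad_h: "trace_on ker_\<alpha> (br h) = a"
proof -
  obtain S where S: "finite S" "ker_\<alpha> = span S"
    using subspace_finite_span[OF subspace_ker_\<alpha>] .
  define s where "s = (\<lambda>x. br h x - ip x (J h) *\<^sub>R a *\<^sub>R J h)"
  have lin: "linear s"
    unfolding s_def
    by (intro linear_compose_sub linear_br_right linearI) (simp_all add: ip_simps algebra_simps)
  have "ip (s x) x = 0" if "x \<in> ker_\<alpha>" for x
    using that
    by (simp add: s_def ker_\<alpha>_def ip_simps ip_br_h_self power2_eq_square ip_sym[of "J h" x])
  then have "trace_on ker_\<alpha> s = 0"
    by (rule trace_on_skew[OF S lin, rotated]) (auto simp: s_def ker_\<alpha>_def \<alpha>_simps)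
  moreover have "trace_on ker_\<alpha> (\<lambda>x. ip x (J h) *\<^sub>R a *\<^sub>R J h) = a"
    by (subst trace_on_rank_one[OF S linear_ip_left])
      (auto simp: ker_\<alpha>_def \<alpha>_simps ip_simps ip_J_J)
  moreover have "trace_on ker_\<alpha> (\<lambda>x. s x + ip x (J h) *\<^sub>R a *\<^sub>R J h)
      = trace_on ker_\<alpha> s + trace_on ker_\<alpha> (\<lambda>x. ip x (J h) *\<^sub>R a *\<^sub>R J h)"
    by (rule trace_on_add[OF S]) (auto simp: s_def ker_\<alpha>_def \<alpha>_simps)
  ultimately show ?thesis by (simp add: s_def)
qed

lemma tr_ad_h: "tr_ad h = a"
proof -
  obtain S where S: "finite S" "(UNIV :: 'a set) = span S"
    using ex_finite_span_UNIV by metis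
  define v where "v = br h \<xi>"
  \<comment> \<open>On the whole algebra the image \<open>v\<close> of \<open>\<xi>\<close> must be
    removed as well; this costs no trace, because \<open>\<alpha>\<close> vanishes on
    brackets.\<close>
  define s where "s = (\<lambda>x. br h x - (\<alpha> x *\<^sub>R v + ip x (J h) *\<^sub>R a *\<^sub>R J h))"
  have lin: "linear s"
    unfolding s_def
    by (intro linear_compose_sub linear_compose_add linear_br_right linearI)
      (simp_all add: ip_simps \<alpha>_simps algebra_simps)
  have "ip (s x) x = 0" for x
  proof -
    \<comment> \<open>\<open>s\<close> kills \<open>\<xi>\<close> and takes values orthogonal to it,
      so only the component \<open>y\<close> in \<open>ker_\<alpha>\<close> matters.\<close>
    define y where "y = x - \<alpha> x *\<^sub>R \<xi>"
    have y: "\<alpha> y = 0" by (simp add: y_def \<alpha>_simps)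
    have x: "x = y + \<alpha> x *\<^sub>R \<xi>" by (simp add: y_def)
    have xJ: "ip x (J h) = ip y (J h)" by (subst x) (simp add: ip_simps ip_sym[of \<xi>] ip_\<xi>)
    have "s x = br h y - ip y (J h) *\<^sub>R a *\<^sub>R J h"
      unfolding s_def xJ by (subst x) (simp add: br_simps v_def \<alpha>_simps y)
    then have "ip (s x) x = ip (br h y - ip y (J h) *\<^sub>R a *\<^sub>R J h) y"
      by (subst (2) x) (simp add: ip_simps ip_\<xi> \<alpha>_simps)
    then show ?thesis
      by (simp add: ip_simps ip_br_h_self[OF y] power2_eq_square ip_sym[of "J h" y])
  qed
  then have "trace_on UNIV s = 0" using trace_on_skew[OF S lin] by simp
  moreover have "trace_on UNIV (\<lambda>x. \<alpha> x *\<^sub>R v) = 0"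
    by (subst trace_on_rank_one[OF S linear_\<alpha>]) (auto simp: v_def)
  moreover have "trace_on UNIV (\<lambda>x. ip x (J h) *\<^sub>R a *\<^sub>R J h) = a"
    by (subst trace_on_rank_one[OF S linear_ip_left]) (auto simp: ip_simps ip_J_J)
  ultimately have "trace_on UNIV (\<lambda>x. s x + (\<alpha> x *\<^sub>R v + ip x (J h) *\<^sub>R a *\<^sub>R J h)) = a"
    by (simp add: trace_on_add[OF S])
  then show ?thesis by (simp add: tr_ad_def s_def)
qed

lemma unimodular_iff_a: "unimodular UNIV br \<longleftrightarrow> a = 0"
proof
  assume "a = 0"
  show "unimodular UNIV br"
    unfolding unimodular_iff
  proof
    fix y
    obtain c where "y - c *\<^sub>R h \<in> U" using U_complement[OF h_notin_U] .
    then have "tr_ad (y - c *\<^sub>R h) = 0" by (rule tr_ad_U)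
    then show "tr_ad y = 0"
      using \<open>a = 0\<close> tr_ad_h
      by (simp add: linear_diff[OF linear_tr_ad] linear_scale[OF linear_tr_ad])
  qed
qed (use tr_ad_h in \<open>auto simp: unimodular_iff\<close>)

lemma br_h_J_h_zero_iff: "br h (J h) = 0 \<longleftrightarrow> a = 0"
proof -
  have "J h \<noteq> 0" using ip_J_J[of h h] by (auto simp: ip_simps)
  then show ?thesis by (simp add: br_h_J_h)
qed

lemma not_unimodular_ker_\<alpha>: "a \<noteq> 0 \<Longrightarrow> \<not> unimodular ker_\<alpha> br"
  using trace_ker_\<alpha>_ad_h \<alpha>_h by (auto simp: unimodular_def ker_\<alpha>_def intro!: exI[of _ h])

lemma almost_abelian_ker_\<alpha>: "almost_abelian ker_\<alpha> br"
  unfolding almost_abelian_def codim_one_ideal_def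
proof (intro exI[of _ "ker_\<alpha> \<inter> U"] conjI)
  have W: "subspace (ker_\<alpha> \<inter> U)" by (rule subspace_inter[OF subspace_ker_\<alpha> subspace_U])
  then show "lie_ideal ker_\<alpha> br (ker_\<alpha> \<inter> U)"
    using br_U by (auto simp: lie_ideal_def ker_\<alpha>_def)
  obtain S where S: "finite S" "ker_\<alpha> = span S"
    using subspace_finite_span[OF subspace_ker_\<alpha>] .
  show "dim ker_\<alpha> = dim (ker_\<alpha> \<inter> U) + 1"
  proof (rule dim_insert_complement[OF S(1) _ W subspace_ker_\<alpha>])
    show "\<exists>c. x - c *\<^sub>R h \<in> ker_\<alpha> \<inter> U" if "x \<in> ker_\<alpha>" for x
      using that ker_\<alpha>_split[of x] by (auto simp: ker_\<alpha>_def \<alpha>_simps intro!: exI[of _ "ip x h"])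
    show "ker_\<alpha> \<subseteq> span S" using S(2) by simp
    show "h \<in> ker_\<alpha>" by (simp add: ker_\<alpha>_def)
  qed (use h_notin_U in auto)
  show "lie_abelian (ker_\<alpha> \<inter> U) br" using br_U_U by (simp add: lie_abelian_def)
qed

text \<open>If \<open>\<xi>\<close> lies in the abelian ideal, then \<open>ad \<xi>\<close> kills the hyperplane \<open>\<hh> \<inter> \<uu>\<close> of \<open>\<hh>\<close>,
  and a skew-symmetric map of rank at most one vanishes.\<close>

lemma br_\<xi>_zero:
  assumes "\<xi> \<in> U"
  shows "br \<xi> x = 0"
proof -
  define v where "v = br \<xi> h"
  \<comment> \<open>Skewness moves \<open>br \<xi>\<close> onto \<open>v\<close>; as
    \<open>v\<close> and \<open>\<xi>\<close> both lie in the abelian \<open>U\<close>, the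
    right-hand side is zero.\<close>
  have "ip v v = - ip h (br \<xi> v)" unfolding v_def by (rule br_\<xi>_skew) auto
  moreover have "v \<in> U"
    unfolding v_def using br_U[OF assms, of h] br_swap[of \<xi> h] subspace_neg[OF subspace_U] by simp
  then have "br \<xi> v = 0" by (rule br_U_U[OF assms])
  ultimately have "v = 0" by (auto simp: ip_simps intro: ip_self_zeroD)
  moreover obtain c where "x - c *\<^sub>R h \<in> U" using U_complement[OF h_notin_U] .
  then have "br \<xi> (x - c *\<^sub>R h) = 0" by (rule br_U_U[OF assms])
  ultimately show ?thesis by (simp add: br_simps v_def)
qed

end

theorem corollary4p8:
  fixes br :: "'g::real_vector \<Rightarrow> 'g \<Rightarrow> 'g"
    and e\<^sub>0 \<xi> :: 'g
    and J D M :: "'g \<Rightarrow> 'g"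
    and \<alpha> :: "'g \<Rightarrow> real"
    and ip :: "'g \<Rightarrow> 'g \<Rightarrow> real"
    and \<uu> \<hh> :: "'g set"
    and n :: nat
  assumes "lie_algebra_on (UNIV :: 'g set) br"
    and "dim (UNIV :: 'g set) = 2 * n + 1"
    and "almost_abelian_decomp UNIV br e\<^sub>0 M \<uu>"
    and "cokahler_structure UNIV br \<xi> J \<alpha> ip"
    and "cokahler_decomp UNIV br \<xi> \<alpha> D \<hh>"
  shows "(\<not> lie_abelian \<hh> br \<longrightarrow> \<hh> \<noteq> \<uu>) \<and>
    (\<hh> \<noteq> \<uu> \<longrightarrow> (\<exists>h\<^sub>0. unit_normal_in ip \<hh> (\<hh> \<inter> \<uu>) h\<^sub>0)) \<and>
    (\<forall>h\<^sub>0. (\<hh> \<noteq> \<uu> \<longrightarrow> unit_normal_in ip \<hh> (\<hh> \<inter> \<uu>) h\<^sub>0) \<longrightarrow>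
       (unimodular UNIV br \<longleftrightarrow> lie_abelian \<hh> br \<or> (\<hh> \<noteq> \<uu> \<and> br h\<^sub>0 (J h\<^sub>0) = 0))) \<and>
    (\<not> unimodular UNIV br \<longrightarrow>
       lie_algebra_on \<hh> br \<and> \<not> unimodular \<hh> br \<and> almost_abelian \<hh> br \<and>
       kahler_structure \<hh> br J ip \<and>
       lie_isomorphism (\<hh> \<times> (UNIV :: real set)) (product_bracket br (\<lambda>s t. 0)) UNIV br
         (\<lambda>(x, t). x + t *\<^sub>R \<xi>) \<and>
       (\<forall>x\<in>\<hh>. D x = 0))"
proof -
  interpret cokahler_almost_abelian ip br \<xi> J \<alpha> \<uu> e\<^sub>0
    using assms(1,3,4)
    by unfold_locales (auto simp: cokahler_structure_def almost_abelian_decomp_def)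
  have h: "\<hh> = ker_\<alpha>" and D: "\<And>x. x \<in> \<hh> \<Longrightarrow> D x = br \<xi> x"
    using assms(5) by (auto simp: cokahler_decomp_def ker_\<alpha>_def)
  have abel: "\<not> lie_abelian \<hh> br \<longrightarrow> \<hh> \<noteq> \<uu>" using abelian by blast
  have ex: "\<hh> \<noteq> \<uu> \<longrightarrow> (\<exists>h\<^sub>0. unit_normal_in ip \<hh> (\<hh> \<inter> \<uu>) h\<^sub>0)"
    using ex_unit_normal h by blast
  have iff: "unimodular UNIV br \<longleftrightarrow> lie_abelian \<hh> br \<or> (\<hh> \<noteq> \<uu> \<and> br h\<^sub>0 (J h\<^sub>0) = 0)"
    if normal: "\<hh> \<noteq> \<uu> \<longrightarrow> unit_normal_in ip \<hh> (\<hh> \<inter> \<uu>) h\<^sub>0" for h\<^sub>0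
  proof (cases "\<hh> = \<uu>")
    case True
    \<comment> \<open>Here \<open>h\<^sub>0\<close> is arbitrary, but both sides hold:
      \<open>\<hh>\<close> is abelian, and \<open>\<xi>\<close> lies outside
      \<open>\<uu>\<close>.\<close>
    then show ?thesis using abelian unimodular_if_ker_\<alpha>_eq_U h by simp
  next
    case False
    then interpret cokahler_unit_normal ip br \<xi> J \<alpha> \<uu> e\<^sub>0 h\<^sub>0
      using normal h by unfold_locales simp
    \<comment> \<open>The abelian alternative is thus contained in the other one, which amounts to
      \<open>a = 0\<close>.\<close>
    have "br h\<^sub>0 (J h\<^sub>0) = 0" if "lie_abelian \<hh> br"
      using that by (simp add: lie_abelian_def h ker_\<alpha>_def)
    then show ?thesis using False unimodular_iff_a br_h_J_h_zero_iff by blast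
  qed
  have "lie_algebra_on \<hh> br \<and> \<not> unimodular \<hh> br \<and> almost_abelian \<hh> br \<and>
       kahler_structure \<hh> br J ip \<and>
       lie_isomorphism (\<hh> \<times> (UNIV :: real set)) (product_bracket br (\<lambda>s t. 0)) UNIV br
         (\<lambda>(x, t). x + t *\<^sub>R \<xi>) \<and>
       (\<forall>x\<in>\<hh>. D x = 0)" if nu: "\<not> unimodular UNIV br"
  proof -
    have "\<hh> \<noteq> \<uu>" using nu unimodular_if_ker_\<alpha>_eq_U h by blast
    then obtain h\<^sub>0 where "unit_normal_in ip \<hh> (\<hh> \<inter> \<uu>) h\<^sub>0" using ex by blast
    then interpret cokahler_unit_normal ip br \<xi> J \<alpha> \<uu> e\<^sub>0 h\<^sub>0
      using h by unfold_locales simp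
    have "\<And>x. br \<xi> x = 0" using br_\<xi>_zero nu unimodular_if_\<xi>_notin_U by blast
    then show ?thesis
      using lie_algebra_ker_\<alpha> kahler_ker_\<alpha> almost_abelian_ker_\<alpha> product_isomorphism D
        not_unimodular_ker_\<alpha> nu unimodular_iff_a by (simp add: h)
  qed
  with abel ex iff show ?thesis by blast
qed

end
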